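(* Let $A$ be a real $2\times2$ matrix. If the system $\frac{dX}{dt}=AX$ has a reactive attractor at the origin, with reactivity radius $\delta_R$, then the maximal amplification $\rho_{max}$ is bounded above by $$\rho_{max}<\frac{1}{\cos(2\delta_R)}=-\frac{p}{m_R}.$$
   Context: For $A=\begin{pmatrix} a_{11} & a_{12}\\ a_{21} & a_{22}\end{pmatrix}$ real put $m_R=\tfrac12(a_{11}+a_{22})$, $p=\tfrac12\sqrt{(a_{11}-a_{22})^2+(a_{12}+a_{21})^2}$ and, if $p\ne0$, $\theta_R=\tfrac12\arctan(a_{12}+a_{21},a_{11}-a_{22})\in\mathbb{R}\pmod\pi$, where $\arctan(y,x)\in\mathbb{R}\pmod{2\pi}$ is the polar angle of $(x,y)$. The radial function is $\mathcal{R}(\theta)=m_R+p\cos(2(\theta-\theta_R))$. If $\mathcal{R}\not\equiv0$ has a zero, the reactivity radius $\delta_R\ge0$ is defined by $\mathcal{R}(\theta_R-\delta_R)=\mathcal{R}(\theta_R+\delta_R)=0$ and $\mathcal{R}>0$ on $(\theta_R-\delta_R,\theta_R+\delta_R)\subset\mathbb{R}\pmod\pi$. For a solution $X(t)$ with $X(0)=X_0$ let $r(t)=\|X(t)\|$ (Euclidean norm), $r_0=\|X_0\|$. The system is reactive if its reactivity $\max_{X_0\ne0}\left(\frac1{r_0}\frac{dr}{dt}\Big|_{t=0}\right)$ is positive. The origin is an attractor when all eigenvalues of $A$ have negative real part; a reactive attractor is an attractor of a reactive system. For a reactive attractor, the maximal amplification is $\rho_{max}=\max_{X_0\neq0,\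 t>0}\frac{r(t)}{r_0}$. *)

theory Defs
  imports "HOL-Analysis.Analysis"
begin

definition m_R :: "real^2^2 \<Rightarrow> real" where
  "m_R A = (A$1$1 + A$2$2) / 2"

definition p_R :: "real^2^2 \<Rightarrow> real" where
  "p_R A = sqrt ((A$1$1 - A$2$2)^2 + (A$1$2 + A$2$1)^2) / 2"

(* The angle is only determined modulo pi; this is its representative in (-pi/2, pi/2].
   It is meaningful for p_R A \<noteq> 0 only (Arg 0 = 0 is a dummy value, which the radial
   function below does not see because it multiplies the cosine by p_R A = 0). *)
definition theta_R :: "real^2^2 \<Rightarrow> real" where
  "theta_R A = Arg (Complex (A$1$1 - A$2$2) (A$1$2 + A$2$1)) / 2"

definition radial :: "real^2^2 \<Rightarrow> real \<Rightarrow> real" where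
  "radial A \<theta> = m_R A + p_R A * cos (2 * (\<theta> - theta_R A))"

(* The radial function is pi-periodic, so positivity on an arc of the circle of reals
   modulo pi is positivity on the corresponding interval of reals. *)
definition is_reactivity_radius :: "real^2^2 \<Rightarrow> real \<Rightarrow> bool" where
  "is_reactivity_radius A \<delta> \<longleftrightarrow>
     (\<exists>\<theta>. radial A \<theta> \<noteq> 0) \<and> 0 \<le> \<delta> \<and>
     radial A (theta_R A - \<delta>) = 0 \<and> radial A (theta_R A + \<delta>) = 0 \<and>
     (\<forall>\<theta>\<in>{theta_R A - \<delta> <..< theta_R A + \<delta>}. radial A \<theta> > 0)"

definition reactivity_radius :: "real^2^2 \<Rightarrow> real" where
  "reactivity_radius A = (THE \<delta>. is_reactivity_radius A \<delta>)"

definition is_solution :: "real^2^2 \<Rightarrow> (real \<Rightarrow> real^2) \<Rightarrow> bool" where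
  "is_solution A X \<longleftrightarrow> (\<forall>t. (X has_vector_derivative (A *v X t)) (at t))"

(* GREATEST is the maximum: the element of the set that bounds all the others. *)
definition reactivity :: "real^2^2 \<Rightarrow> real" where
  "reactivity A = (GREATEST \<mu>. \<mu> \<in>
     {1 / norm (X 0) * deriv (\<lambda>t. norm (X t)) 0 | X. is_solution A X \<and> X 0 \<noteq> 0})"

definition reactive :: "real^2^2 \<Rightarrow> bool" where
  "reactive A \<longleftrightarrow> reactivity A > 0"

definition is_eigenvalue :: "real^2^2 \<Rightarrow> complex \<Rightarrow> bool" where
  "is_eigenvalue A z \<longleftrightarrow>
     (\<exists>v :: complex^2. v \<noteq> 0 \<and> map_matrix complex_of_real A *v v = z *s v)"

definition attractor :: "real^2^2 \<Rightarrow> bool" where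
  "attractor A \<longleftrightarrow> (\<forall>z. is_eigenvalue A z \<longrightarrow> Re z < 0)"

definition reactive_attractor :: "real^2^2 \<Rightarrow> bool" where
  "reactive_attractor A \<longleftrightarrow> attractor A \<and> reactive A"

definition max_amplification :: "real^2^2 \<Rightarrow> real" where
  "max_amplification A = (GREATEST \<rho>. \<rho> \<in>
     {norm (X t) / norm (X 0) | X t. is_solution A X \<and> X 0 \<noteq> 0 \<and> t > 0})"

end

theory Submission imports Defs begin

text \<open>
  Rotate (and, if necessary, reflect) the plane so that the quadratic form of \<open>A\<close> is diagonal:
  with \<open>u = cos \<delta>\<close>, \<open>v = sin \<delta>\<close> the system becomes
  \<open>x' = 2pv\<^sup>2x - \<omega>y\<close>, \<open>y' = \<omega>x - 2pu\<^sup>2y\<close> with \<open>\<omega> > 0\<close>, the norm grows exactly inside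
  the double cone \<open>\<bar>y\<bar> u < \<bar>x\<bar> v\<close>, and asymptotic stability says \<open>\<omega> > 2puv\<close>. In the degenerate
  case \<open>\<omega> = 2puv\<close> the linear form \<open>L = ux - vy\<close> is conserved; for larger \<open>\<omega>\<close> its modulus decreases
  strictly inside the cone. On an entry ray of the cone \<open>\<bar>L\<bar>\<close> is the norm, on an exit ray it is the
  norm times \<open>u\<^sup>2 - v\<^sup>2 = cos (2\<delta>)\<close>, so one passage through the cone amplifies by less than
  \<open>1 / cos (2\<delta>)\<close>. A trajectory that realises the maximal amplification starts on an entry ray,
  because extending it backwards cannot improve the ratio, and makes only one passage, because
  returning to the line of the initial vector with at least the initial norm contradicts stability.
\<close>

section \<open>Amplification during one passage through the growth cone\<close>

text \<open>A one-sided second derivative test: \<open>h\<close> is stationary at \<open>a\<close>,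
  but its derivative turns positive to the right of \<open>a\<close>. It excludes a maximum of the
  norm on an entry ray.\<close>

lemma DERIV_pos_right_increasing:
  fixes h g :: "real \<Rightarrow> real"
  assumes h: "\<And>s. (h has_real_derivative c * g s) (at s)" and "c > 0"
    and g: "(g has_real_derivative D) (at a)" "g a = 0" "D > 0"
  shows "\<exists>b>a. h a < h b"
proof -
  obtain d where d: "d > 0" "\<And>e. 0 < e \<Longrightarrow> e < d \<Longrightarrow> g a < g (a + e)"
    using DERIV_pos_inc_right[OF g(1) g(3)] by blast
  have "h a < h (a + d/2)"
  proof (rule DERIV_pos_imp_increasing_open[where f = h])
    fix s assume "a < s" "s < a + d/2"
    then have "g s > 0" using d(2)[of "s - a"] g(2) by auto
    then show "\<exists>y. (h has_real_derivative y) (at s) \<and> y > 0"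
      using h \<open>c > 0\<close> by (meson mult_pos_pos)
  next
    show "continuous_on {a..a + d/2} h" by (rule DERIV_continuous_on[OF has_field_derivative_at_within[OF h]])
  qed (use d in auto)
  then show ?thesis using d(1) by (intro exI[of _ "a + d/2"]) auto
qed

text \<open>\<open>min\<close> and \<open>max\<close> express that the ratio of \<open>h t\<close>
  to \<open>h 0\<close> is optimal: neither another start up to time \<open>t\<close>, negative
  times included, nor another end improves it. \<open>noret\<close> carries the stability that
  forbids a second passage.\<close>

lemma planar_amplification:
  fixes x y :: "real \<Rightarrow> real" and u v p \<omega> t :: real
  defines "h \<equiv> \<lambda>s. (x s)\<^sup>2 + (y s)\<^sup>2"
  assumes p: "p > 0" and v: "0 < v" "v < u" and uv: "u\<^sup>2 + v\<^sup>2 = 1" and om: "\<omega> > 2 * p * u * v"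
    and dx: "\<And>s. (x has_real_derivative 2 * p * v\<^sup>2 * x s - \<omega> * y s) (at s)"
    and dy: "\<And>s. (y has_real_derivative \<omega> * x s - 2 * p * u\<^sup>2 * y s) (at s)"
    and nz: "h 0 > 0" and t: "t > 0"
    and min: "\<And>s. s \<le> t \<Longrightarrow> h 0 \<le> h s" and max: "\<And>s. s \<ge> 0 \<Longrightarrow> h s \<le> h t"
    and noret: "\<And>s \<kappa>. s > 0 \<Longrightarrow> x s = \<kappa> * x 0 \<Longrightarrow> y s = \<kappa> * y 0 \<Longrightarrow> \<bar>\<kappa>\<bar> < 1"
  shows "h t * (u\<^sup>2 - v\<^sup>2)\<^sup>2 < h 0"
proof -
  \<comment> \<open>The excess over the degenerate frequency, at which \<open>L\<close> is
    conserved; in general \<open>L\<close> has derivative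
    \<open>- \<epsilon> * \<alpha>\<close>.\<close>
  define \<epsilon> where "\<epsilon> = \<omega> - 2 * p * u * v"
  \<comment> \<open>The entry rays of the cone are \<open>\<alpha> = 0\<close>, the exit rays \<open>\<beta> = 0\<close>, and the norm grows where \<open>g > 0\<close>.\<close>
  define \<alpha> where "\<alpha> s = v * x s + u * y s" for s
  define \<beta> where "\<beta> s = v * x s - u * y s" for s
  define L where "L s = u * x s - v * y s" for s
  define g where "g s = \<alpha> s * \<beta> s" for s
  \<comment> \<open>The product rule is left unexpanded: only the first summand survives on an entry
    ray, only the second on an exit ray.\<close>
  define g' where "g' s = (2 * p * (u\<^sup>2 + v\<^sup>2) * \<beta> s + \<epsilon> * L s) * \<beta> s
     + \<alpha> s * (2 * p * (v\<^sup>2 - u\<^sup>2) * \<beta> s - \<epsilon> * (u * x s + v * y s))" for s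
  have u: "u > 0" and eps: "\<epsilon> > 0" using v om by (auto simp: \<epsilon>_def)
  have om_eq: "\<omega> = \<epsilon> + 2 * p * u * v" by (simp add: \<epsilon>_def)
  have dh: "(h has_real_derivative (4 * p) * g s) (at s)" for s
    unfolding h_def g_def \<alpha>_def \<beta>_def
    by (rule derivative_eq_intros dx dy refl)+ (simp add: power2_eq_square algebra_simps)
  have d\<alpha>: "(\<alpha> has_real_derivative 2 * p * (u\<^sup>2 + v\<^sup>2) * \<beta> s + \<epsilon> * L s) (at s)" for s
    unfolding \<alpha>_def \<beta>_def L_def
    by (rule derivative_eq_intros dx dy refl)+ (simp add: om_eq power2_eq_square algebra_simps)
  have d\<beta>: "(\<beta> has_real_derivative 2 * p * (v\<^sup>2 - u\<^sup>2) * \<beta> s - \<epsilon> * (u * x s + v * y s)) (at s)" for s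
    unfolding \<beta>_def
    by (rule derivative_eq_intros dx dy refl)+ (simp add: om_eq power2_eq_square algebra_simps)
  have dL: "(L has_real_derivative - \<epsilon> * \<alpha> s) (at s)" for s
    unfolding L_def \<alpha>_def
    by (rule derivative_eq_intros dx dy refl)+ (simp add: om_eq power2_eq_square algebra_simps)
  have dg: "(g has_real_derivative g' s) (at s)" for s
    unfolding g_def g'_def by (rule derivative_eq_intros d\<alpha> d\<beta> refl)+ (simp add: algebra_simps)
  have pos: "h s > 0" if "s \<le> t" for s using min[OF that] nz by linarith
  \<comment> \<open>On an entry ray \<open>\<beta>\<close> and \<open>L\<close> are both positive
    multiples of \<open>x\<close>, so the two surviving terms have the same sign.\<close>
  have entry: "g' s > 0" if "s \<le> t" "\<alpha> s = 0" for s
  proof -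
    have y: "y s = - (v / u) * x s" using that(2) u by (simp add: \<alpha>_def field_simps)
    then have "x s \<noteq> 0" using pos[OF that(1)] by (auto simp: h_def)
    moreover have "\<beta> s = 2 * v * x s" using that(2) by (simp add: \<alpha>_def \<beta>_def)
    moreover have "L s = (u\<^sup>2 + v\<^sup>2) * x s / u"
      using u by (simp add: L_def y field_simps power2_eq_square)
    then have "L s = x s / u" using uv by simp
    ultimately have "g' s = 8 * p * v\<^sup>2 * (x s)\<^sup>2 + \<epsilon> * 2 * v / u * (x s)\<^sup>2"
      using that(2) uv by (simp add: g'_def power2_eq_square algebra_simps)
    then show ?thesis using \<open>x s \<noteq> 0\<close> p u v eps by (auto intro!: add_pos_pos mult_pos_pos)
  qed
  have leave: "g' s < 0" if "s \<le> t" "\<beta> s = 0" for s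
  proof -
    have y: "y s = (v / u) * x s" using that(2) u by (simp add: \<beta>_def field_simps)
    then have "x s \<noteq> 0" using pos[OF that(1)] by (auto simp: h_def)
    moreover have "\<alpha> s = 2 * v * x s" using that(2) by (simp add: \<alpha>_def \<beta>_def)
    moreover have "u * x s + v * y s = (u\<^sup>2 + v\<^sup>2) * x s / u"
      using u by (simp add: y field_simps power2_eq_square)
    then have "u * x s + v * y s = x s / u" using uv by simp
    ultimately have "g' s = - (\<epsilon> * 2 * v / u * (x s)\<^sup>2)"
      using that(2) by (simp add: g'_def power2_eq_square algebra_simps)
    then show ?thesis using \<open>x s \<noteq> 0\<close> u v eps by auto
  qed
  have zero: "\<alpha> s = 0 \<or> \<beta> s = 0" if "g s = 0" for s using that by (simp add: g_def)
  have cont: "continuous_on S g" for S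
    by (rule DERIV_continuous_on[OF has_field_derivative_at_within[OF dg]])

  \<comment> \<open>Since \<open>min\<close> covers negative times, 0 is an interior minimum of
    \<open>h\<close>. The start is thus on some ray of the cone; on an exit ray the norm would fall
    at once below its minimum.\<close>
  have "4 * p * g 0 = 0"
    by (rule DERIV_local_min[OF dh, of t]) (use t min in auto)
  then have g0: "g 0 = 0" using p by simp
  have \<alpha>0: "\<alpha> 0 = 0"
  proof (rule ccontr)
    assume "\<alpha> 0 \<noteq> 0"
    then have "g' 0 < 0" using zero[OF g0] leave t by auto
    obtain d where d: "d > 0" "\<And>e. 0 < e \<Longrightarrow> e < d \<Longrightarrow> g (0 + e) < g 0"
      using DERIV_neg_dec_right[OF dg \<open>g' 0 < 0\<close>] by blast
    define b where "b = min (d/2) t"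
    have b: "0 < b" "b < d" "b \<le> t" using d t by (auto simp: b_def)
    have "h b < h 0"
    proof (rule DERIV_neg_imp_decreasing_open[where f = h])
      fix s assume "0 < s" "s < b"
      then have "4 * p * g s < 0" using d(2)[of s] g0 b p by (simp add: mult_pos_neg)
      then show "\<exists>y. (h has_real_derivative y) (at s) \<and> y < 0" using dh by blast
    next
      show "continuous_on {0..b} h" by (rule DERIV_continuous_on[OF has_field_derivative_at_within[OF dh]])
    qed (use b in auto)
    with min[of b] b show False by simp
  qed
  have "4 * p * g t = 0"
    by (rule DERIV_local_max[OF dh, of t]) (use t max in auto)
  then have gt: "g t = 0" using p by simp
  have "\<alpha> t \<noteq> 0"
  proof
    assume "\<alpha> t = 0"
    then obtain b where "b > t" "h t < h b"
      using DERIV_pos_right_increasing[OF dh _ dg gt] entry p by (metis order_refl zero_less_mult_iff zero_less_numeral)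
    with max[of b] t show False by simp
  qed
  then have \<beta>t: "\<beta> t = 0" using zero[OF gt] by simp
  \<comment> \<open>The trajectory leaves the cone at \<open>t\<close>, so \<open>g\<close> is
    positive just before. Cutting \<open>Z\<close> off at \<open>t - d/2\<close> below therefore
    loses no time before \<open>t\<close> outside the cone and makes \<open>Z\<close>
    compact.\<close>
  obtain d where d: "d > 0" "\<And>e. 0 < e \<Longrightarrow> e < d \<Longrightarrow> g t < g (t - e)"
    using DERIV_neg_dec_left[OF dg leave[OF order_refl \<beta>t]] by blast
  have gpos: "g z > 0" if z: "0 < z" "z < t" for z
  proof (rule ccontr)
    assume "\<not> g z > 0"
    \<comment> \<open>At the last time \<open>s\<close> outside the cone the trajectory is on an entry ray, hence on the initial line.\<close>
    define Z where "Z = {0..t - d/2} \<inter> g -` {..0}"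
    have zZ: "w \<in> Z" if "0 \<le> w" "w < t" "g w \<le> 0" for w
      using d(2)[of "t - w"] that gt d(1) by (cases "t - w < d") (auto simp: Z_def)
    have "compact Z"
      unfolding compact_eq_bounded_closed
    proof
      show "bounded Z" by (rule bounded_subset[of "{0..t - d/2}"]) (auto simp: Z_def)
      show "closed Z" unfolding Z_def by (rule continuous_closed_preimage[OF cont]) auto
    qed
    moreover have "z \<in> Z" using zZ z \<open>\<not> g z > 0\<close> by auto
    ultimately obtain s where s: "s \<in> Z" "\<And>w. w \<in> Z \<Longrightarrow> w \<le> s"
      using compact_attains_sup[of Z] by blast
    have s': "0 < s" "s < t" "g s \<le> 0" using s(1) s(2)[OF \<open>z \<in> Z\<close>] z d(1) by (auto simp: Z_def)
    have right: "g w > 0" if "s < w" "w < t" for w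
      using zZ[of w] s(2)[of w] that s' by force
    have gs: "g s = 0"
    proof (rule ccontr)
      assume "g s \<noteq> 0"
      obtain w where "s \<le> w" "w \<le> (s+t)/2" "g w = 0"
        using IVT'[of g s 0 "(s+t)/2"] cont s' right[of "(s+t)/2"] by auto
      with right[of w] s' \<open>g s \<noteq> 0\<close> show False by (cases "w = s") auto
    qed
    \<comment> \<open>On an exit ray \<open>g\<close> would be negative just after \<open>s\<close>,
      against the choice of \<open>s\<close> as the last such time.\<close>
    have "\<alpha> s = 0"
    proof (rule ccontr)
      assume "\<alpha> s \<noteq> 0"
      then have "g' s < 0" using zero[OF gs] leave s' by auto
      then obtain c where c: "c > 0" "\<And>e. 0 < e \<Longrightarrow> e < c \<Longrightarrow> g (s + e) < g s"
        using DERIV_neg_dec_right[OF dg] by blast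
      define e where "e = min (c/2) ((t-s)/2)"
      have "0 < e" "e < c" "e < t - s" using c s' by (auto simp: e_def min_def)
      then show False using c(2)[of e] right[of "s + e"] gs by auto
    qed
    have y: "y 0 = - (v / u) * x 0" "y s = - (v / u) * x s"
      using \<alpha>0 \<open>\<alpha> s = 0\<close> u by (auto simp: \<alpha>_def field_simps)
    then have x0: "x 0 \<noteq> 0" using nz by (auto simp: h_def)
    define \<kappa> where "\<kappa> = x s / x 0"
    have \<kappa>: "x s = \<kappa> * x 0" "y s = \<kappa> * y 0" using x0 y by (auto simp: \<kappa>_def)
    have "\<kappa>\<^sup>2 * h 0 \<ge> 1 * h 0"
      using min[of s] s' by (simp add: h_def \<kappa> power_mult_distrib algebra_simps)
    then have "\<kappa>\<^sup>2 \<ge> 1" using nz by (simp add: mult_le_cancel_right)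
    then have "\<bar>\<kappa>\<bar> \<ge> 1" by (simp add: abs_square_less_1 flip: not_less)
    with noret[OF s'(1) \<kappa>] show False by simp
  qed
  have "(L t)\<^sup>2 < (L 0)\<^sup>2"
  proof (rule DERIV_neg_imp_decreasing_open[where f = "\<lambda>s. (L s)\<^sup>2", OF t])
    fix s assume s: "0 < s" "s < t"
    \<comment> \<open>Both coefficients are positive because \<open>0 < v < u\<close>. Multiplying
      by \<open>\<alpha> s\<close> shows that \<open>L\<close> and \<open>\<alpha>\<close> have the
      same sign inside the cone, which makes the square of \<open>L\<close> decrease.\<close>
    have "L s = (u\<^sup>2 - v\<^sup>2) / (2 * u * v) * \<alpha> s + 1 / (2 * u * v) * \<beta> s"
      using u v by (simp add: L_def \<alpha>_def \<beta>_def field_simps flip: uv) (simp add: power2_eq_square algebra_simps)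
    then have "\<alpha> s * L s = (u\<^sup>2 - v\<^sup>2) / (2 * u * v) * (\<alpha> s)\<^sup>2 + 1 / (2 * u * v) * g s"
      by (simp add: g_def power2_eq_square algebra_simps)
    also have "\<dots> > 0" using gpos[OF s] u v by (intro add_nonneg_pos) auto
    finally have "2 * L s * (- \<epsilon> * \<alpha> s) < 0" using eps by (auto simp: zero_less_mult_iff mult_less_0_iff) 
    moreover have "((\<lambda>s. (L s)\<^sup>2) has_real_derivative 2 * L s * (- \<epsilon> * \<alpha> s)) (at s)"
      by (rule derivative_eq_intros dL refl)+ simp
    ultimately show "\<exists>y. ((\<lambda>s. (L s)\<^sup>2) has_real_derivative y) (at s) \<and> y < 0" by blast
  next
    show "continuous_on {0..t} (\<lambda>s. (L s)\<^sup>2)"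
      by (intro continuous_on_power DERIV_continuous_on[OF has_field_derivative_at_within[OF dL]])
  qed
  \<comment> \<open>\<open>L\<close> and \<open>\<alpha>\<close> are the coordinates of the point in
    an orthonormal frame, so \<open>\<alpha> 0 = 0\<close> leaves the whole norm in
    \<open>L\<close>.\<close>
  moreover have "(L 0)\<^sup>2 = h 0"
  proof -
    have "(L 0)\<^sup>2 + (\<alpha> 0)\<^sup>2 = (u\<^sup>2 + v\<^sup>2) * h 0"
      by (simp add: L_def \<alpha>_def h_def power2_eq_square algebra_simps)
    then show ?thesis using \<alpha>0 uv by simp
  qed
  moreover have "(L t)\<^sup>2 = h t * (u\<^sup>2 - v\<^sup>2)\<^sup>2"
  proof -
    have y: "y t = (v / u) * x t" using \<beta>t u by (simp add: \<beta>_def field_simps)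
    have "h t = (x t)\<^sup>2 * (u\<^sup>2 + v\<^sup>2) / u\<^sup>2" using u by (simp add: h_def y field_simps)
    moreover have "L t = x t * (u\<^sup>2 - v\<^sup>2) / u" using u by (simp add: L_def y field_simps power2_eq_square)
    ultimately show ?thesis by (simp add: uv power_mult_distrib power_divide)
  qed
  ultimately show ?thesis by simp
qed

section \<open>The linear flow: explicit solutions, uniqueness forward in time, decay\<close>

text \<open>Splitting off \<open>exp (m * t)\<close> turns the system into z'' = q z, solved by
  hyperbolic, linear or trigonometric functions according to the sign of \<open>q\<close>. The bound
  on \<open>q\<close> says that any exponential growth is slower than the decay of
  \<open>exp (m * t)\<close>.\<close>

lemma oscillator_fundamental_pair:
  fixes q m :: real
  assumes m: "m < 0" and q: "q < m\<^sup>2"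
  obtains C S :: "real \<Rightarrow> real" where "C 0 = 1" "S 0 = 0"
    "\<And>t. (C has_real_derivative q * S t) (at t)" "\<And>t. (S has_real_derivative C t) (at t)"
    "((\<lambda>t. exp (m * t) * C t) \<longlongrightarrow> 0) at_top" "((\<lambda>t. exp (m * t) * S t) \<longlongrightarrow> 0) at_top"
proof -
  have decay: "((\<lambda>t. exp (c * t)) \<longlongrightarrow> 0) at_top" if "c < 0" for c :: real
    by (rule filterlim_compose[OF exp_at_bot])
       (rule filterlim_tendsto_neg_mult_at_bot[OF tendsto_const that filterlim_ident])
  consider "q > 0" | "q = 0" | "q < 0" by linarith
  then show ?thesis
  proof cases
    case 1
    define k where "k = sqrt q"
    have k: "k > 0" "k * k = q" using 1 by (auto simp: k_def)
    have "k < \<bar>m\<bar>" using q real_less_rsqrt real_sqrt_less_iff[of q "m\<^sup>2"] by (simp add: k_def)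
    then have lims: "((\<lambda>t. exp ((m + k) * t)) \<longlongrightarrow> 0) at_top" "((\<lambda>t. exp ((m - k) * t)) \<longlongrightarrow> 0) at_top"
      using m k by (auto intro!: decay)
    show ?thesis
    proof (rule that[of "\<lambda>t. cosh (k * t)" "\<lambda>t. sinh (k * t) / k"])
      show "((\<lambda>t. cosh (k * t)) has_real_derivative q * (sinh (k * t) / k)) (at t)" for t
        using k by (auto intro!: derivative_eq_intros)
      show "((\<lambda>t. sinh (k * t) / k) has_real_derivative cosh (k * t)) (at t)" for t
        using k by (auto intro!: derivative_eq_intros)
      have "((\<lambda>t. (exp ((m + k) * t) + exp ((m - k) * t)) / 2) \<longlongrightarrow> (0 + 0) / 2) at_top"
        by (intro tendsto_intros lims) auto
      moreover have "(exp ((m + k) * t) + exp ((m - k) * t)) / 2 = exp (m * t) * cosh (k * t)" for t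
        by (simp add: cosh_def algebra_simps flip: exp_add)
      ultimately show "((\<lambda>t. exp (m * t) * cosh (k * t)) \<longlongrightarrow> 0) at_top" by simp
      have "((\<lambda>t. (exp ((m + k) * t) - exp ((m - k) * t)) / (2 * k)) \<longlongrightarrow> (0 - 0) / (2 * k)) at_top"
        using k by (intro tendsto_intros lims) auto
      moreover have "(exp ((m + k) * t) - exp ((m - k) * t)) / (2 * k) = exp (m * t) * (sinh (k * t) / k)" for t
        by (simp add: sinh_def algebra_simps diff_divide_distrib flip: exp_add)
      ultimately show "((\<lambda>t. exp (m * t) * (sinh (k * t) / k)) \<longlongrightarrow> 0) at_top" by simp
    qed auto
  next
    case 2
    show ?thesis
    proof (rule that[of "\<lambda>t. 1" "\<lambda>t. t"])
      have "((\<lambda>t. (- m * t) ^ 1 / exp (- m * t)) \<longlongrightarrow> 0) at_top"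
        using m by (intro filterlim_compose[OF tendsto_power_div_exp_0]
          filterlim_tendsto_pos_mult_at_top[OF tendsto_const _ filterlim_ident]) auto
      from tendsto_divide[OF this tendsto_const[of "- m"]] m
      show "((\<lambda>t. exp (m * t) * t) \<longlongrightarrow> 0) at_top"
        by (simp add: exp_minus field_simps)
    qed (use 2 decay[OF m] in \<open>auto intro!: derivative_eq_intros\<close>)
  next
    case 3
    define k where "k = sqrt (- q)"
    have k: "k > 0" "q = - (k * k)" using 3 by (auto simp: k_def)
    show ?thesis
    proof (rule that[of "\<lambda>t. cos (k * t)" "\<lambda>t. sin (k * t) / k"])
      show "((\<lambda>t. cos (k * t)) has_real_derivative q * (sin (k * t) / k)) (at t)" for t
        using k by (auto intro!: derivative_eq_intros simp: field_simps)
      show "((\<lambda>t. sin (k * t) / k) has_real_derivative cos (k * t)) (at t)" for t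
        using k by (auto intro!: derivative_eq_intros)
      show "((\<lambda>t. exp (m * t) * cos (k * t)) \<longlongrightarrow> 0) at_top"
        by (rule Lim_null_comparison[OF _ decay[OF m]]) (auto simp: abs_mult intro!: always_eventually mult_left_le)
      have "((\<lambda>t. exp (m * t) * sin (k * t)) \<longlongrightarrow> 0) at_top"
        by (rule Lim_null_comparison[OF _ decay[OF m]]) (auto simp: abs_mult intro!: always_eventually mult_left_le)
      from tendsto_divide[OF this tendsto_const[of k]] k
      show "((\<lambda>t. exp (m * t) * (sin (k * t) / k)) \<longlongrightarrow> 0) at_top" by simp
    qed auto
  qed
qed

lemma is_solution_translate: "is_solution A X \<Longrightarrow> is_solution A (\<lambda>t. X (t + s))"
  unfolding is_solution_def
proof
  fix t
  assume "\<forall>t. (X has_vector_derivative A *v X t) (at t)"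
  then have "(X has_vector_derivative A *v X (t + s)) (at (t + s))" by blast
  moreover have "((\<lambda>t. t + s) has_vector_derivative 1) (at t)" by (auto intro!: derivative_eq_intros)
  ultimately show "((\<lambda>t. X (t + s)) has_vector_derivative A *v X (t + s)) (at t)"
    using vector_diff_chain_at[of "\<lambda>t. t + s" 1 t X] by (simp add: o_def)
qed

lemma is_solution_scaleR: "is_solution A X \<Longrightarrow> is_solution A (\<lambda>t. c *\<^sub>R X t)"
  unfolding is_solution_def
  by (auto intro!: derivative_eq_intros simp: matrix_vector_mult_scaleR)

lemma is_solution_diff: "is_solution A X \<Longrightarrow> is_solution A Y \<Longrightarrow> is_solution A (\<lambda>t. X t - Y t)"
  unfolding is_solution_def
  by (auto intro!: derivative_eq_intros simp: matrix_vector_mult_diff_distrib)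

lemma is_solution_norm_sq_deriv:
  assumes "is_solution A X"
  shows "((\<lambda>t. (norm (X t))\<^sup>2) has_real_derivative 2 * (X t \<bullet> (A *v X t))) (at t)"
proof -
  have "(X has_derivative (\<lambda>h. h *\<^sub>R (A *v X t))) (at t)"
    using assms by (auto simp: is_solution_def has_vector_derivative_def)
  from has_derivative_inner[OF this this] show ?thesis
    unfolding has_field_derivative_def power2_norm_eq_inner
    by (rule has_derivative_eq_rhs) (auto simp: inner_commute algebra_simps)
qed

text \<open>A Gronwall argument: with \<open>K\<close> the operator norm of \<open>A\<close>, the
  squared norm damped by \<open>exp (- (2 * K) * t)\<close> cannot increase.\<close>

lemma is_solution_zero_forward:
  assumes X: "is_solution A X" and "X s = 0" "s \<le> t"
  shows "X t = 0"
proof -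
  define K where "K = onorm ((*v) A)"
  have bound: "X t \<bullet> (A *v X t) \<le> K * (norm (X t))\<^sup>2" for t
  proof -
    have "X t \<bullet> (A *v X t) \<le> norm (X t) * norm (A *v X t)" by (rule norm_cauchy_schwarz)
    also have "\<dots> \<le> norm (X t) * (K * norm (X t))"
      unfolding K_def by (intro mult_left_mono onorm matrix_vector_mul_bounded_linear) auto
    finally show ?thesis by (simp add: power2_eq_square algebra_simps)
  qed
  define f where "f t = exp (- (2 * K) * t) * (norm (X t))\<^sup>2" for t
  have "f t \<le> f s"
  proof (rule DERIV_nonpos_imp_nonincreasing[OF \<open>s \<le> t\<close>])
    fix w
    have "(f has_real_derivative exp (- (2 * K) * w) * (2 * (X w \<bullet> (A *v X w) - K * (norm (X w))\<^sup>2))) (at w)"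
      unfolding f_def
      by (rule derivative_eq_intros is_solution_norm_sq_deriv[OF X] refl)+ (simp add: algebra_simps)
    then show "\<exists>y. (f has_real_derivative y) (at w) \<and> y \<le> 0"
      using bound[of w] by (intro exI conjI) (auto intro!: mult_nonneg_nonpos)
  qed
  then have "f t \<le> 0" using assms by (simp add: f_def)
  then show ?thesis by (simp add: f_def mult_le_0_iff not_le)
qed

lemma is_solution_unique_forward:
  assumes "is_solution A X" "is_solution A Y" "X s = Y s" "s \<le> t"
  shows "X t = Y t"
  using is_solution_zero_forward[OF is_solution_diff[OF assms(1,2)], of s t] assms by simp

text \<open>The trace-free part \<open>B\<close> of \<open>A\<close> satisfies B^2 = q I by
  Cayley-Hamilton, so the flow is a combination of the identity and \<open>B\<close> with scalar
  coefficients. Continuity and decay of the flow reduce to those of \<open>a\<close> and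
  \<open>b\<close>.\<close>

lemma flow_representation:
  fixes A :: "real^2^2"
  assumes m: "m_R A < 0" and det: "det A > 0"
  obtains a b :: "real \<Rightarrow> real" and B :: "real^2^2" where "a 0 = 1" "b 0 = 0"
    "continuous_on UNIV a" "continuous_on UNIV b"
    "\<And>x. is_solution A (\<lambda>t. a t *\<^sub>R x + b t *\<^sub>R (B *v x))"
    "(a \<longlongrightarrow> 0) at_top" "(b \<longlongrightarrow> 0) at_top"
proof -
  define m where "m = m_R A"
  define q where "q = m\<^sup>2 - det A"
  obtain C S where CS: "C 0 = 1" "S 0 = 0"
    "\<And>t. (C has_real_derivative q * S t) (at t)" "\<And>t. (S has_real_derivative C t) (at t)"
    "((\<lambda>t. exp (m * t) * C t) \<longlongrightarrow> 0) at_top" "((\<lambda>t. exp (m * t) * S t) \<longlongrightarrow> 0) at_top"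
    using oscillator_fundamental_pair[of m q] m det by (auto simp: m_def q_def)
  define B where "B = A - m *\<^sub>R mat 1"
  define a where "a t = exp (m * t) * C t" for t
  define b where "b t = exp (m * t) * S t" for t
  have BB: "B *v (B *v x) = q *\<^sub>R x" for x
    by (simp add: vec_eq_iff forall_2 B_def matrix_vector_mult_def sum_2 mat_def q_def det_2 m_def m_R_def
        power2_eq_square field_simps)
  have A: "A *v x = m *\<^sub>R x + B *v x" for x
    by (simp add: B_def matrix_vector_mult_diff_rdistrib flip: scaleR_matrix_vector_assoc)
  have da: "(a has_real_derivative m * a t + q * b t) (at t)" for t
    unfolding a_def b_def by (rule derivative_eq_intros CS refl)+ (simp add: algebra_simps)
  have db: "(b has_real_derivative m * b t + a t) (at t)" for t
    unfolding a_def b_def by (rule derivative_eq_intros CS refl)+ (simp add: algebra_simps)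
  show ?thesis
  proof (rule that[of a b B])
    show "is_solution A (\<lambda>t. a t *\<^sub>R x + b t *\<^sub>R (B *v x))" for x
      unfolding is_solution_def
    proof
      fix t
      show "((\<lambda>t. a t *\<^sub>R x + b t *\<^sub>R (B *v x)) has_vector_derivative
        A *v (a t *\<^sub>R x + b t *\<^sub>R (B *v x))) (at t)"
        by (rule derivative_eq_intros da db refl)+
           (simp add: A matrix_vector_right_distrib matrix_vector_mult_scaleR BB algebra_simps)
    qed
    show "continuous_on UNIV a" "continuous_on UNIV b" 
      by (rule DERIV_continuous_on[OF has_field_derivative_at_within] da db)+
  qed (use CS in \<open>auto simp: a_def[abs_def] b_def[abs_def]\<close>)
qed

lemma flow_tendsto_0:
  fixes A :: "real^2^2"
  assumes "m_R A < 0" "det A > 0" and X: "is_solution A X"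
  shows "(X \<longlongrightarrow> 0) at_top"
proof -
  obtain a b B where ab: "a 0 = 1" "b 0 = 0"
    "continuous_on UNIV a" "continuous_on UNIV b"
    "\<And>x. is_solution A (\<lambda>t. a t *\<^sub>R x + b t *\<^sub>R (B *v x))"
    "(a \<longlongrightarrow> 0) at_top" "(b \<longlongrightarrow> 0) at_top"
    by (rule flow_representation[OF assms(1,2)]) (rule that)
  have "((\<lambda>t. a t *\<^sub>R X 0 + b t *\<^sub>R (B *v X 0)) \<longlongrightarrow> 0 *\<^sub>R X 0 + 0 *\<^sub>R (B *v X 0)) at_top"
    by (intro tendsto_intros ab)
  moreover have "a t *\<^sub>R X 0 + b t *\<^sub>R (B *v X 0) = X t" if "t \<ge> 0" for t
    by (rule is_solution_unique_forward[OF ab(5) X _ that]) (simp add: ab(1,2))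
  then have "eventually (\<lambda>t. a t *\<^sub>R X 0 + b t *\<^sub>R (B *v X 0) = X t) at_top"
    by (rule eventually_at_top_linorderI)
  ultimately show ?thesis by (simp add: Lim_transform_eventually)
qed

text \<open>By uniqueness, advancing by \<open>s\<close> multiplies the whole forward trajectory by
  \<open>\<kappa>\<close>. With modulus at least 1 the norms at multiples of \<open>s\<close> would
  not tend to 0.\<close>

lemma flow_no_return:
  fixes A :: "real^2^2"
  assumes A: "m_R A < 0" "det A > 0" and X: "is_solution A X" "X 0 \<noteq> 0"
    and s: "s > 0" "X s = \<kappa> *\<^sub>R X 0"
  shows "\<bar>\<kappa>\<bar> < 1"
proof (rule ccontr)
  assume \<kappa>: "\<not> \<bar>\<kappa>\<bar> < 1"
  have step: "X (t + s) = \<kappa> *\<^sub>R X t" if "t \<ge> 0" for t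
    by (rule is_solution_unique_forward[OF is_solution_translate[OF X(1)] is_solution_scaleR[OF X(1)], of 0])
      (use s that in auto)
  have "norm (X (real n * s)) \<ge> norm (X 0)" for n
  proof (induction n)
    case (Suc n)
    have "norm (X (real (Suc n) * s)) = \<bar>\<kappa>\<bar> * norm (X (real n * s))"
      using step[of "real n * s"] s by (simp add: algebra_simps)
    also have "\<dots> \<ge> 1 * norm (X (real n * s))" using \<kappa> by (intro mult_right_mono) auto
    finally show ?case using Suc by simp
  qed simp
  moreover have "filterlim (\<lambda>n. real n * s) at_top sequentially"
    using s by (intro filterlim_at_top_mult_tendsto_pos[OF tendsto_const] filterlim_real_sequentially) auto
  then have "((\<lambda>n. norm (X (real n * s))) \<longlonglongrightarrow> 0)"
    by (intro tendsto_norm_zero filterlim_compose[OF flow_tendsto_0[OF A X(1)]])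
  ultimately have "norm (X 0) \<le> 0" by (intro LIMSEQ_le_const) auto
  with X(2) show False by simp
qed

section \<open>From eigenvalues to trace and determinant\<close>

lemma quadratic_root_is_eigenvalue:
  fixes A :: "real^2^2"
  assumes z: "(z - of_real (A$1$1)) * (z - of_real (A$2$2)) = of_real (A$1$2) * of_real (A$2$1)"
  shows "is_eigenvalue A z"
proof -
  have eig: "is_eigenvalue A z" if "v \<noteq> 0 \<or> w \<noteq> 0"
    "of_real (A$1$1) * v + of_real (A$1$2) * w = z * v" "of_real (A$2$1) * v + of_real (A$2$2) * w = z * w"
    for v w :: complex
    unfolding is_eigenvalue_def
    by (rule exI[of _ "vector [v, w]"])
      (use that in \<open>auto simp: vec_eq_iff forall_2 map_matrix_def matrix_vector_mult_def sum_2\<close>)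
  \<comment> \<open>The eigenvector is read off the first row, else off the second; if both
    candidates may vanish, the second unit vector serves.\<close>
  consider "A$1$2 \<noteq> 0" | "z \<noteq> of_real (A$2$2)" | "A$1$2 = 0" "z = of_real (A$2$2)" by blast
  then show ?thesis
  proof cases
    case 1
    then show ?thesis using z by (intro eig[of "of_real (A$1$2)" "z - of_real (A$1$1)"]) (auto simp: algebra_simps)
  next
    case 2
    then show ?thesis using z by (intro eig[of "z - of_real (A$2$2)" "of_real (A$2$1)"]) (auto simp: algebra_simps)
  next
    case 3
    then show ?thesis by (intro eig[of 0 1]) auto
  qed
qed

lemma attractor_trace_det:
  fixes A :: "real^2^2"
  assumes "attractor A"
  shows "m_R A < 0" "det A > 0"
proof -
  define m q where "m = m_R A" and "q = m\<^sup>2 - det A"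
  \<comment> \<open>The principal square root has nonnegative real part, so this is an eigenvalue of
    largest real part and controls both signs.\<close>
  define z where "z = of_real m + csqrt (of_real q)"
  have "(z - of_real (A$1$1)) * (z - of_real (A$2$2)) - of_real (A$1$2) * of_real (A$2$1)
     = (z - of_real m)\<^sup>2 - of_real q"
    by (simp add: q_def m_def m_R_def det_2 power2_eq_square field_simps)
  also have "\<dots> = 0" by (simp add: z_def)
  finally have "is_eigenvalue A z" by (intro quadratic_root_is_eigenvalue) simp
  then have neg: "m + Re (csqrt (of_real q)) < 0"
    using assms by (auto simp: attractor_def z_def)
  then show m: "m_R A < 0" using Re_csqrt[of "of_real q"] unfolding m_def by linarith
  show "det A > 0"
  proof (cases "q \<ge> 0")
    case True
    then have "sqrt q < - m" using neg by (simp add: csqrt_of_real_nonneg)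
    then have "(sqrt q)\<^sup>2 < (- m)\<^sup>2" using True by (intro power_strict_mono) auto
    then show ?thesis using True by (simp add: q_def)
  next
    case False
    then show ?thesis using zero_le_power2[of m] unfolding q_def by linarith
  qed
qed

section \<open>Polar form of the matrix and its quadratic form\<close>

lemma polar_entries:
  fixes A :: "real^2^2"
  defines "c \<equiv> cos (theta_R A)" and "s \<equiv> sin (theta_R A)"
  shows "A$1$1 = m_R A + p_R A * (c\<^sup>2 - s\<^sup>2)" "A$2$2 = m_R A - p_R A * (c\<^sup>2 - s\<^sup>2)"
    "A$1$2 = 2 * p_R A * s * c - (A$2$1 - A$1$2) / 2" "A$2$1 = 2 * p_R A * s * c + (A$2$1 - A$1$2) / 2"
proof -
  define z where "z = Complex (A$1$1 - A$2$2) (A$1$2 + A$2$1)"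
  have z: "cmod z = 2 * p_R A" "Arg z = 2 * theta_R A"
    by (auto simp: z_def cmod_def p_R_def theta_R_def)
  have "z = rcis (2 * p_R A) (2 * theta_R A)" using rcis_cmod_Arg[of z] z by simp
  then have "A$1$1 - A$2$2 = 2 * p_R A * (c\<^sup>2 - s\<^sup>2)" "A$1$2 + A$2$1 = 2 * p_R A * (2 * s * c)"
    unfolding c_def s_def cos_double[symmetric] sin_double[symmetric]
    by (simp_all add: z_def complex_eq_iff)
  then show "A$1$1 = m_R A + p_R A * (c\<^sup>2 - s\<^sup>2)" "A$2$2 = m_R A - p_R A * (c\<^sup>2 - s\<^sup>2)"
    "A$1$2 = 2 * p_R A * s * c - (A$2$1 - A$1$2) / 2" "A$2$1 = 2 * p_R A * s * c + (A$2$1 - A$1$2) / 2"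
    by (simp_all add: m_R_def field_simps)
qed

lemma p_R_nonneg: "p_R A \<ge> 0"
  by (simp add: p_R_def)

lemma norm_sq_vec2: "(norm x)\<^sup>2 = (x$1)\<^sup>2 + (x$2)\<^sup>2" for x :: "real^2"
  unfolding power2_norm_eq_inner by (simp add: inner_vec_def sum_2 power2_eq_square)

text \<open>Only the symmetric part of \<open>A\<close> contributes; rotation by
  \<open>theta_R A\<close> diagonalises it with eigenvalues m + p and m - p.\<close>

lemma quadratic_form_polar:
  fixes A :: "real^2^2" and x :: "real^2"
  defines "c \<equiv> cos (theta_R A)" and "s \<equiv> sin (theta_R A)"
  shows "x \<bullet> (A *v x) = m_R A * (norm x)\<^sup>2 + p_R A * ((c * x$1 + s * x$2)\<^sup>2 - (c * x$2 - s * x$1)\<^sup>2)"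
proof -
  have "x \<bullet> (A *v x) = A$1$1 * (x$1)\<^sup>2 + (A$1$2 + A$2$1) * (x$1 * x$2) + A$2$2 * (x$2)\<^sup>2"
    by (simp add: inner_vec_def sum_2 matrix_vector_mult_def power2_eq_square algebra_simps)
  also have "A$1$2 + A$2$1 = 4 * p_R A * s * c"
    using polar_entries(3,4)[of A] by (simp add: c_def s_def)
  also have "A$1$1 = m_R A + p_R A * (c\<^sup>2 - s\<^sup>2)" unfolding c_def s_def by (rule polar_entries)
  also have "A$2$2 = m_R A - p_R A * (c\<^sup>2 - s\<^sup>2)" unfolding c_def s_def by (rule polar_entries)
  finally show ?thesis
    unfolding norm_sq_vec2 by (simp add: power2_eq_square algebra_simps)
qed

lemma rotated_norm_sq:
  fixes x :: "real^2"
  shows "(cos \<theta> * x$1 + sin \<theta> * x$2)\<^sup>2 + (cos \<theta> * x$2 - sin \<theta> * x$1)\<^sup>2 = (norm x)\<^sup>2"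
proof -
  have "(cos \<theta> * x$1 + sin \<theta> * x$2)\<^sup>2 + (cos \<theta> * x$2 - sin \<theta> * x$1)\<^sup>2
      = ((sin \<theta>)\<^sup>2 + (cos \<theta>)\<^sup>2) * ((x$1)\<^sup>2 + (x$2)\<^sup>2)"
    by (simp only: power2_eq_square) algebra
  then show ?thesis by (simp add: norm_sq_vec2)
qed

lemma quadratic_form_le:
  fixes A :: "real^2^2"
  shows "x \<bullet> (A *v x) \<le> (m_R A + p_R A) * (norm x)\<^sup>2"
proof -
  define X Y where "X = (cos (theta_R A) * x$1 + sin (theta_R A) * x$2)\<^sup>2"
    and "Y = (cos (theta_R A) * x$2 - sin (theta_R A) * x$1)\<^sup>2"
  have "X - Y \<le> (norm x)\<^sup>2" using rotated_norm_sq[where \<theta> = "theta_R A" and x = x]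
      zero_le_power2[of "cos (theta_R A) * x$2 - sin (theta_R A) * x$1"] unfolding X_def Y_def by linarith
  then have "p_R A * (X - Y) \<le> p_R A * (norm x)\<^sup>2" by (intro mult_left_mono p_R_nonneg)
  then show ?thesis unfolding quadratic_form_polar X_def Y_def by (simp add: algebra_simps)
qed

lemma quadratic_form_max_attained:
  fixes A :: "real^2^2"
  obtains x where "norm x = 1" "x \<bullet> (A *v x) = m_R A + p_R A"
proof (rule that)
  let ?x = "vector [cos (theta_R A), sin (theta_R A)] :: real^2"
  have "(norm ?x)\<^sup>2 = 1"
    by (simp add: norm_sq_vec2)
  then show n: "norm ?x = 1" using norm_ge_zero[of ?x] by (simp add: power2_eq_1_iff del: norm_ge_zero)
  show "?x \<bullet> (A *v ?x) = m_R A + p_R A"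
    unfolding quadratic_form_polar n by (simp flip: power2_eq_square)
qed

lemma is_solution_deriv_norm:
  assumes "is_solution A X" "X t \<noteq> 0"
  shows "((\<lambda>t. norm (X t)) has_real_derivative (X t \<bullet> (A *v X t)) / norm (X t)) (at t)"
proof -
  have "((\<lambda>t. sqrt ((norm (X t))\<^sup>2)) has_real_derivative
      inverse (sqrt ((norm (X t))\<^sup>2)) / 2 * (2 * (X t \<bullet> (A *v X t)))) (at t)"
    using assms by (intro DERIV_chain2[OF DERIV_real_sqrt is_solution_norm_sq_deriv]) auto
  then show ?thesis by (simp add: field_simps)
qed

section \<open>Reactivity, reactivity radius and maximal amplification\<close>

lemma solution_exists:
  fixes A :: "real^2^2"
  assumes "m_R A < 0" "det A > 0"
  obtains X where "is_solution A X" "X 0 = x"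
proof -
  obtain a b B where ab: "a 0 = 1" "b 0 = 0"
    "continuous_on UNIV a" "continuous_on UNIV b"
    "\<And>x. is_solution A (\<lambda>t. a t *\<^sub>R x + b t *\<^sub>R (B *v x))"
    "(a \<longlongrightarrow> 0) at_top" "(b \<longlongrightarrow> 0) at_top"
    by (rule flow_representation[OF assms]) (rule that)
  show ?thesis using that[OF ab(5)[of x]] ab(1,2) by simp
qed

text \<open>The initial growth rate of the norm is the Rayleigh quotient, maximal at the top
  eigenvector of the symmetric part. The sign conditions supply a solution starting there.\<close>

lemma reactivity_eq:
  fixes A :: "real^2^2"
  assumes A: "m_R A < 0" "det A > 0"
  shows "reactivity A = m_R A + p_R A"
proof -
  have val: "1 / norm (X 0) * deriv (\<lambda>t. norm (X t)) 0 = (X 0 \<bullet> (A *v X 0)) / (norm (X 0))\<^sup>2"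
    if "is_solution A X" "X 0 \<noteq> 0" for X
    using DERIV_imp_deriv[OF is_solution_deriv_norm[OF that]] by (simp add: power2_eq_square)
  obtain x where x: "norm x = 1" "x \<bullet> (A *v x) = m_R A + p_R A"
    by (rule quadratic_form_max_attained)
  obtain X where X: "is_solution A X" "X 0 = x" using solution_exists[OF A] by blast
  have "X 0 \<noteq> 0" using X x by auto
  show ?thesis
    unfolding reactivity_def
  proof (rule Greatest_equality)
    show "m_R A + p_R A \<in> {1 / norm (X 0) * deriv (\<lambda>t. norm (X t)) 0 |X. is_solution A X \<and> X 0 \<noteq> 0}"
      using val[OF X(1) \<open>X 0 \<noteq> 0\<close>] X x \<open>X 0 \<noteq> 0\<close> by (intro CollectI exI[of _ X]) auto
  next
    fix \<mu> assume "\<mu> \<in> {1 / norm (X 0) * deriv (\<lambda>t. norm (X t)) 0 |X. is_solution A X \<and> X 0 \<noteq> 0}"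
    then obtain Y where Y: "\<mu> = 1 / norm (Y 0) * deriv (\<lambda>t. norm (Y t)) 0" "is_solution A Y" "Y 0 \<noteq> 0" by blast
    show "\<mu> \<le> m_R A + p_R A"
      unfolding Y(1) val[OF Y(2,3)] using quadratic_form_le[of "Y 0" A] Y(3) by (simp add: divide_le_eq)
  qed
qed

lemma reactivity_radius_eq:
  fixes A :: "real^2^2"
  assumes m: "m_R A < 0" and p: "m_R A + p_R A > 0"
  shows "reactivity_radius A = arccos (- m_R A / p_R A) / 2"
proof -
  define m q \<delta> where "m = m_R A" and "q = p_R A" and "\<delta> = arccos (- m / q) / 2"
  have mq: "m < 0" "q > 0" "m + q > 0" using assms by (auto simp: m_def q_def)
  have r: "-1 \<le> - m / q" "- m / q \<le> 1" using mq by (auto simp: field_simps)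
  have c: "cos (2 * \<delta>) = - m / q" using r by (simp add: \<delta>_def)
  have \<delta>: "0 \<le> \<delta>" "2 * \<delta> \<le> pi" using arccos_lbound[OF r] arccos_ubound[OF r] by (auto simp: \<delta>_def)
  have rad: "radial A (theta_R A + e) = m + q * cos (2 * e)" for e
    by (simp add: radial_def m_def q_def)
  have ok: "is_reactivity_radius A \<delta>"
    unfolding is_reactivity_radius_def
  proof (intro conjI ballI)
    show "\<exists>\<theta>. radial A \<theta> \<noteq> 0" using rad[of 0] mq by (intro exI[of _ "theta_R A + 0"]) auto
    show "radial A (theta_R A - \<delta>) = 0" "radial A (theta_R A + \<delta>) = 0"
      using rad[of \<delta>] rad[of "- \<delta>"] c mq by auto
    fix \<theta> assume \<theta>: "\<theta> \<in> {theta_R A - \<delta><..<theta_R A + \<delta>}"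
    define e where "e = \<bar>\<theta> - theta_R A\<bar>"
    have "e < \<delta>" "0 \<le> e" using \<theta> by (auto simp: e_def)
    then have "cos (2 * \<delta>) < cos (2 * e)" using \<delta> by (intro cos_monotone_0_pi) auto
    then have "q * (- m / q) < q * cos (2 * e)" unfolding c using mq by (intro mult_strict_left_mono)
    then have "m + q * cos (2 * e) > 0" using mq by simp
    moreover have "2 * e = \<bar>2 * (\<theta> - theta_R A)\<bar>" by (simp add: e_def abs_mult del: right_diff_distrib_numeral)
    then have "cos (2 * e) = cos (2 * (\<theta> - theta_R A))" by (simp only: cos_abs_real)
    ultimately show "radial A \<theta> > 0" by (simp add: radial_def m_def q_def)
  qed (rule \<delta>)
  have "reactivity_radius A = \<delta>"
    unfolding reactivity_radius_def
  proof (rule the_equality[of "is_reactivity_radius A", OF ok])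
    fix \<delta>' assume *: "is_reactivity_radius A \<delta>'"
    \<comment> \<open>Of two different radii, the smaller would give a zero of
      \<open>radial A\<close> inside the positivity interval of the larger.\<close>
    have "\<not> \<delta> < \<delta>'" "\<not> \<delta>' < \<delta>"
      using ok * unfolding is_reactivity_radius_def by (smt (verit) greaterThanLessThan_iff)+
    then show "\<delta>' = \<delta>" by simp
  qed
  then show ?thesis by (simp add: \<delta>_def m_def q_def)
qed

text \<open>Homogeneity reduces to unit initial vectors and uniform decay to a bounded time
  interval, where compactness yields a maximum. This also shows that the \<open>GREATEST\<close> in
  the definition denotes an actual maximum.\<close>

lemma max_amplification_attained:
  fixes A :: "real^2^2"
  assumes A: "m_R A < 0" "det A > 0" and re: "m_R A + p_R A > 0"
  obtains X t where "is_solution A X" "X 0 \<noteq> 0" "t > 0"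
    "norm (X t) = max_amplification A * norm (X 0)" "max_amplification A > 1"
    "\<And>Y s. is_solution A Y \<Longrightarrow> s \<ge> 0 \<Longrightarrow> norm (Y s) \<le> max_amplification A * norm (Y 0)"
proof -
  obtain a b B where ab: "a 0 = 1" "b 0 = 0"
    "continuous_on UNIV a" "continuous_on UNIV b"
    "\<And>x. is_solution A (\<lambda>t. a t *\<^sub>R x + b t *\<^sub>R (B *v x))"
    "(a \<longlongrightarrow> 0) at_top" "(b \<longlongrightarrow> 0) at_top"
    by (rule flow_representation[OF A]) (rule that)
  define \<Phi> where "\<Phi> t x = a t *\<^sub>R x + b t *\<^sub>R (B *v x)" for t x
  have sol: "is_solution A (\<lambda>t. \<Phi> t x)" "\<Phi> 0 x = x" for x
    using ab by (auto simp: \<Phi>_def)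
  have scale: "\<Phi> t (r *\<^sub>R x) = r *\<^sub>R \<Phi> t x" for t r x
    by (simp add: \<Phi>_def matrix_vector_mult_scaleR algebra_simps)
  have flow: "Y s = \<Phi> s (Y 0)" if "is_solution A Y" "s \<ge> 0" for Y s
    using is_solution_unique_forward[OF that(1) sol(1)[of "Y 0"], of 0 s] sol(2) that(2) by simp
  define K where "K = onorm ((*v) B)"
  have "((\<lambda>t. \<bar>a t\<bar> + \<bar>b t\<bar> * K) \<longlongrightarrow> \<bar>0\<bar> + \<bar>0\<bar> * K) at_top" by (intro tendsto_intros ab)
  then have "eventually (\<lambda>t. \<bar>a t\<bar> + \<bar>b t\<bar> * K < 1) at_top" by (intro order_tendstoD(2)[of _ 0]) auto
  then obtain T0 where T0: "\<And>t. t \<ge> T0 \<Longrightarrow> \<bar>a t\<bar> + \<bar>b t\<bar> * K < 1"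
    by (auto simp: eventually_at_top_linorder)
  define T where "T = max T0 0"
  have late: "norm (\<Phi> t x) \<le> 1" if "t \<ge> T" "norm x = 1" for t x
  proof -
    have "norm (\<Phi> t x) \<le> \<bar>a t\<bar> * norm x + \<bar>b t\<bar> * norm (B *v x)"
      unfolding \<Phi>_def by (rule order_trans[OF norm_triangle_ineq]) simp
    also have "\<dots> \<le> \<bar>a t\<bar> * norm x + \<bar>b t\<bar> * (K * norm x)"
      unfolding K_def by (intro add_left_mono mult_left_mono onorm matrix_vector_mul_bounded_linear) auto
    finally show ?thesis using T0[of t] that by (simp add: T_def)
  qed
  \<comment> \<open>Time 0 is included for compactness; growth in the most reactive direction gives
    \<open>M > 1\<close> and so excludes \<open>t0 = 0\<close>.\<close>
  define D where "D = {0..T} \<times> sphere (0::real^2) 1"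
  have "compact D" unfolding D_def by (intro compact_Times) auto
  moreover have "D \<noteq> {}" by (auto simp: D_def T_def)
  moreover have "continuous_on D (\<lambda>(t, x). norm (\<Phi> t x))"
    unfolding \<Phi>_def case_prod_beta
    by (intro continuous_intros continuous_on_compose2[OF ab(3)] continuous_on_compose2[OF ab(4)]
        continuous_on_compose2[OF linear_continuous_on[OF matrix_vector_mul_bounded_linear]]) auto
  ultimately obtain t0 x0 where max: "(t0, x0) \<in> D"
    "\<And>t x. (t, x) \<in> D \<Longrightarrow> norm (\<Phi> t x) \<le> norm (\<Phi> t0 x0)"
    using continuous_attains_sup[of D "\<lambda>(t, x). norm (\<Phi> t x)"] by fastforce
  define M where "M = norm (\<Phi> t0 x0)"
  have x0: "norm x0 = 1" "t0 \<ge> 0" "x0 \<noteq> 0" using max(1) by (auto simp: D_def)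
  obtain x where x: "norm x = 1" "x \<bullet> (A *v x) = m_R A + p_R A"
    by (rule quadratic_form_max_attained)
  have dnorm: "((\<lambda>t. norm (\<Phi> t x)) has_real_derivative m_R A + p_R A) (at 0)"
    using is_solution_deriv_norm[OF sol(1)[of x], of 0] x sol(2)[of x] by (cases "x = 0") auto
  then obtain d where d: "d > 0" "\<And>h. 0 < h \<Longrightarrow> h < d \<Longrightarrow> norm (\<Phi> 0 x) < norm (\<Phi> (0 + h) x)"
    using DERIV_pos_inc_right[OF dnorm re] by blast
  have grow: "norm (\<Phi> (d/2) x) > 1" using d(2)[of "d/2"] d(1) sol(2)[of x] x by simp
  then have "d/2 < T" using late[of "d/2" x] x(1) by force
  then have "(d/2, x) \<in> D" using d(1) x(1) by (auto simp: D_def)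
  then have M1: "M > 1" using max(2) grow by (fastforce simp: M_def)
  have "t0 \<noteq> 0" using M1 x0(1) sol(2)[of x0] by (auto simp: M_def)
  then have "t0 > 0" using x0 by simp
  have unit: "norm (\<Phi> s x) \<le> M" if "norm x = 1" "s \<ge> 0" for s x
  proof (cases "s \<le> T")
    case True
    then show ?thesis using max(2)[of s x] that by (auto simp: D_def M_def)
  next
    case False
    then show ?thesis using late[of s x] that M1 by simp
  qed
  have bound: "norm (Y s) \<le> M * norm (Y 0)" if "is_solution A Y" "s \<ge> 0" for Y s
  proof (cases "Y 0 = 0")
    case True
    then show ?thesis using flow[OF that] by (simp add: \<Phi>_def)
  next
    case False
    have "norm (Y s) = norm (Y 0) * norm (\<Phi> s ((1 / norm (Y 0)) *\<^sub>R Y 0))"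
      using False flow[OF that] by (simp add: scale)
    also have "\<dots> \<le> norm (Y 0) * M" using False that by (intro mult_left_mono unit) auto
    finally show ?thesis by (simp add: mult.commute)
  qed
  have "max_amplification A = M"
    unfolding max_amplification_def
  proof (rule Greatest_equality)
    show "M \<in> {norm (X t) / norm (X 0) |X t. is_solution A X \<and> X 0 \<noteq> 0 \<and> t > 0}"
      using sol[of x0] x0 \<open>t0 > 0\<close> by (intro CollectI exI[of _ "\<lambda>t. \<Phi> t x0"] exI[of _ t0]) (auto simp: M_def)
  next
    fix \<rho> assume "\<rho> \<in> {norm (X t) / norm (X 0) |X t. is_solution A X \<and> X 0 \<noteq> 0 \<and> t > 0}"
    then show "\<rho> \<le> M" using bound by (auto simp: divide_le_eq)
  qed
  then show ?thesis
    using that[of "\<lambda>t. \<Phi> t x0" t0] sol[of x0] x0 \<open>t0 > 0\<close> M1 bound by (auto simp: M_def)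
qed

section \<open>Reduction of the matrix system to the planar one\<close>

theorem theorem7p5:
  fixes A :: "real^2^2"
  assumes "reactive_attractor A"
  shows "max_amplification A < 1 / cos (2 * reactivity_radius A)
    \<and> 1 / cos (2 * reactivity_radius A) = - p_R A / m_R A"
proof -
  define m p \<omega> M where "m = m_R A" and "p = p_R A" and "\<omega> = (A$2$1 - A$1$2) / 2"
    and "M = max_amplification A"
  have A: "m_R A < 0" "det A > 0" using assms attractor_trace_det by (auto simp: reactive_attractor_def)
  have re: "m_R A + p_R A > 0"
    using assms reactivity_eq[OF A] by (simp add: reactive_attractor_def reactive_def)
  have mp: "m < 0" "p > 0" "m + p > 0" using A re by (auto simp: m_def p_def)
  define \<delta> where "\<delta> = reactivity_radius A"
  have \<delta>: "\<delta> = arccos (- m / p) / 2"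
    using reactivity_radius_eq[OF A(1) re] by (simp add: \<delta>_def m_def p_def)
  have r: "-1 < - m / p" "- m / p < 1" "0 < - m / p" using mp by (auto simp: field_simps)
  have cos\<delta>: "cos (2 * \<delta>) = - m / p" using r by (simp add: \<delta>)
  have \<delta>b: "0 < \<delta>" "\<delta> < pi / 2" using arccos_lt_bounded[OF r(1,2)] by (auto simp: \<delta>)
  define u v where "u = cos \<delta>" and "v = sin \<delta>"
  have uv: "u > 0" "v > 0" "u\<^sup>2 + v\<^sup>2 = 1" "u\<^sup>2 - v\<^sup>2 = - m / p"
    using \<delta>b cos\<delta> by (auto simp: u_def v_def cos_gt_zero sin_gt_zero cos_double)
  then have "v\<^sup>2 < u\<^sup>2" using r by simp
  then have "v < u" using uv by (simp add: power2_less_imp_less)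
  have pp: "2 * p * v\<^sup>2 = p + m" "2 * p * u\<^sup>2 = p - m"
  proof -
    have "p * u\<^sup>2 + p * v\<^sup>2 = p" "p * u\<^sup>2 - p * v\<^sup>2 = - m"
      using uv mp by (simp_all flip: distrib_left right_diff_distrib)
    then show "2 * p * v\<^sup>2 = p + m" "2 * p * u\<^sup>2 = p - m" by linarith+
  qed
  define c s where "c = cos (theta_R A)" and "s = sin (theta_R A)"
  have cs: "s\<^sup>2 + c\<^sup>2 = 1" by (simp add: c_def s_def)
  have ent: "A$1$1 = m + p * (c\<^sup>2 - s\<^sup>2)" "A$2$2 = m - p * (c\<^sup>2 - s\<^sup>2)"
    "A$1$2 = 2 * p * s * c - \<omega>" "A$2$1 = 2 * p * s * c + \<omega>"
    using polar_entries[of A] by (simp_all add: m_def p_def c_def s_def \<omega>_def)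
  \<comment> \<open>In polar form, positivity of the determinant is the frequency bound of the
    planar lemma, because the square of \<open>2 * p * u * v\<close> is p^2 - m^2.\<close>
  have "det A = m\<^sup>2 + \<omega>\<^sup>2 - p\<^sup>2 * (s\<^sup>2 + c\<^sup>2)\<^sup>2"
    unfolding det_2 ent by (simp only: power2_eq_square) algebra
  then have "p\<^sup>2 - m\<^sup>2 < \<omega>\<^sup>2" using A cs by simp
  moreover have "(2 * p * u * v)\<^sup>2 = (2 * p * v\<^sup>2) * (2 * p * u\<^sup>2)"
    by (simp add: power2_eq_square algebra_simps)
  ultimately have "(2 * p * u * v)\<^sup>2 < \<bar>\<omega>\<bar>\<^sup>2" unfolding pp by (simp add: power2_eq_square algebra_simps)
  then have om: "2 * p * u * v < \<bar>\<omega>\<bar>" by (rule power_less_imp_less_base) simp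
  obtain X t where X: "is_solution A X" "X 0 \<noteq> 0" "t > 0" "norm (X t) = M * norm (X 0)" "M > 1"
    "\<And>Y s. is_solution A Y \<Longrightarrow> s \<ge> 0 \<Longrightarrow> norm (Y s) \<le> M * norm (Y 0)"
    using max_amplification_attained[OF A re] unfolding M_def by metis
  \<comment> \<open>The reflection that makes the angular speed positive.\<close>
  define \<sigma> where "\<sigma> = (if \<omega> \<ge> 0 then 1 else - 1 :: real)"
  have \<sigma>: "\<sigma> * \<sigma> = 1" "\<omega> = \<sigma> * \<bar>\<omega>\<bar>" by (auto simp: \<sigma>_def)
  define x where "x \<tau> = c * X \<tau> $ 1 + s * X \<tau> $ 2" for \<tau>
  define y where "y \<tau> = \<sigma> * (c * X \<tau> $ 2 - s * X \<tau> $ 1)" for \<tau>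
  have h: "(x \<tau>)\<^sup>2 + (y \<tau>)\<^sup>2 = (norm (X \<tau>))\<^sup>2" for \<tau>
    using rotated_norm_sq[of "theta_R A" "X \<tau>"] \<sigma>(1)
    by (simp add: x_def y_def c_def s_def power_mult_distrib power2_eq_square[of \<sigma>])
  have comp: "((\<lambda>\<tau>. X \<tau> $ i) has_real_derivative (A *v X \<tau>) $ i) (at \<tau>)" for \<tau> i
    using bounded_linear.has_vector_derivative[OF bounded_linear_vec_nth] X(1)
    unfolding is_solution_def has_real_derivative_iff_has_vector_derivative by blast
  have dX: "((\<lambda>\<tau>. X \<tau> $ 1) has_real_derivative A$1$1 * X \<tau> $ 1 + A$1$2 * X \<tau> $ 2) (at \<tau>)"
    "((\<lambda>\<tau>. X \<tau> $ 2) has_real_derivative A$2$1 * X \<tau> $ 1 + A$2$2 * X \<tau> $ 2) (at \<tau>)" for \<tau>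
    using comp[of 1 \<tau>] comp[of 2 \<tau>] by (simp_all add: matrix_vector_mult_def sum_2)
  have dx: "(x has_real_derivative 2 * p * v\<^sup>2 * x \<tau> - \<bar>\<omega>\<bar> * y \<tau>) (at \<tau>)" for \<tau>
  proof -
    have "c * ((m + p * (c\<^sup>2 - s\<^sup>2)) * a + (2 * p * s * c - \<omega>) * b)
       + s * ((2 * p * s * c + \<omega>) * a + (m - p * (c\<^sup>2 - s\<^sup>2)) * b)
       = (p + m) * (c * a + s * b) - \<omega> * (c * b - s * a)" for a b
      using cs by algebra
    moreover have "\<bar>\<omega>\<bar> * y \<tau> = \<omega> * (c * X \<tau> $ 2 - s * X \<tau> $ 1)"
      unfolding y_def by (auto simp: \<sigma>_def)
    ultimately have "c * (A$1$1 * X \<tau> $ 1 + A$1$2 * X \<tau> $ 2) + s * (A$2$1 * X \<tau> $ 1 + A$2$2 * X \<tau> $ 2)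
       = 2 * p * v\<^sup>2 * x \<tau> - \<bar>\<omega>\<bar> * y \<tau>"
      unfolding ent pp x_def by simp
    moreover have "(x has_real_derivative c * (A$1$1 * X \<tau> $ 1 + A$1$2 * X \<tau> $ 2)
       + s * (A$2$1 * X \<tau> $ 1 + A$2$2 * X \<tau> $ 2)) (at \<tau>)"
      unfolding x_def by (intro DERIV_add DERIV_cmult dX)
    ultimately show ?thesis by simp
  qed
  have dy: "(y has_real_derivative \<bar>\<omega>\<bar> * x \<tau> - 2 * p * u\<^sup>2 * y \<tau>) (at \<tau>)" for \<tau>
  proof -
    have "\<sigma> * (c * ((2 * p * s * c + \<omega>) * a + (m - p * (c\<^sup>2 - s\<^sup>2)) * b)
       - s * ((m + p * (c\<^sup>2 - s\<^sup>2)) * a + (2 * p * s * c - \<omega>) * b))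
       = (\<sigma> * \<omega>) * (c * a + s * b) - (p - m) * (\<sigma> * (c * b - s * a))" for a b
      using cs by algebra
    moreover have "\<sigma> * \<omega> = \<bar>\<omega>\<bar>" by (auto simp: \<sigma>_def)
    ultimately have "\<sigma> * (c * (A$2$1 * X \<tau> $ 1 + A$2$2 * X \<tau> $ 2) - s * (A$1$1 * X \<tau> $ 1 + A$1$2 * X \<tau> $ 2))
       = \<bar>\<omega>\<bar> * x \<tau> - 2 * p * u\<^sup>2 * y \<tau>"
      unfolding ent pp x_def y_def by simp
    moreover have "(y has_real_derivative \<sigma> * (c * (A$2$1 * X \<tau> $ 1 + A$2$2 * X \<tau> $ 2)
       - s * (A$1$1 * X \<tau> $ 1 + A$1$2 * X \<tau> $ 2))) (at \<tau>)"
      unfolding y_def by (intro DERIV_diff DERIV_cmult dX)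
    ultimately show ?thesis by simp
  qed
  have M: "M\<^sup>2 * (u\<^sup>2 - v\<^sup>2)\<^sup>2 < 1"
  proof -
    have pos: "norm (X 0) > 0" using X(2) by simp
    have "(norm (X t))\<^sup>2 * (u\<^sup>2 - v\<^sup>2)\<^sup>2 < (norm (X 0))\<^sup>2"
      unfolding h[symmetric]
    proof (rule planar_amplification[OF mp(2) uv(2) \<open>v < u\<close> uv(3) om dx dy _ X(3)], unfold h)
      show "(norm (X 0))\<^sup>2 > 0" using pos by simp
      show "(norm (X 0))\<^sup>2 \<le> (norm (X w))\<^sup>2" if "w \<le> t" for w
      proof -
        \<comment> \<open>Restarting the trajectory at \<open>w\<close>, possibly before time 0,
          cannot amplify by more than \<open>M\<close>, while the original start attains
          \<open>M\<close>.\<close>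
        have "norm (X t) \<le> M * norm (X w)"
          using X(6)[OF is_solution_translate[OF X(1)], of "t - w" w] that by simp
        then show ?thesis using X(4,5) by simp
      qed
      show "(norm (X w))\<^sup>2 \<le> (norm (X t))\<^sup>2" if "w \<ge> 0" for w
        unfolding X(4) by (intro power_mono X(6) X(1) that) auto
      show "\<bar>\<kappa>\<bar> < 1" if "w > 0" "x w = \<kappa> * x 0" "y w = \<kappa> * y 0" for w \<kappa>
      proof (rule flow_no_return[OF A X(1,2) \<open>w > 0\<close>])
        have inv: "X \<tau> $ 1 = c * x \<tau> - s * \<sigma> * y \<tau>" "X \<tau> $ 2 = s * x \<tau> + c * \<sigma> * y \<tau>" for \<tau>
          using cs \<sigma>(1) unfolding x_def y_def by algebra+
        show "X w = \<kappa> *\<^sub>R X 0"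
          by (simp add: vec_eq_iff forall_2 inv that algebra_simps)
      qed
    qed
    then have "(norm (X 0))\<^sup>2 * (M\<^sup>2 * (u\<^sup>2 - v\<^sup>2)\<^sup>2) < (norm (X 0))\<^sup>2 * 1"
      by (simp add: X(4) power_mult_distrib mult_ac)
    then show ?thesis using pos by (simp only: mult_less_cancel_left_pos zero_less_power)
  qed
  then have "(M * (- m / p))\<^sup>2 < 1\<^sup>2" by (simp add: uv power_mult_distrib power_divide)
  then have "M * (- m / p) < 1" by (rule power2_less_imp_less) simp
  then have "M < 1 / (- m / p)" by (simp only: pos_less_divide_eq[OF r(3)])
  moreover have "1 / (- m / p) = - p / m" by simp
  ultimately show ?thesis using cos\<delta> unfolding \<delta>_def M_def m_def p_def by simp
qed

end
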